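(* Let $A$ be a linear operator on a (real or complex) Hilbert space $\mathcal{H}$ whose dimension is finite and even. Then there exists a halving decomposition $\mathcal{H}=\mathcal{F}\oplus\mathcal{F}^{\perp}$ with respect to which $$A=\begin{pmatrix} B & \star\\ \star & B\end{pmatrix}$$ for some operator $B$ (the stars stand for unspecified entries). Explicitly: there exist a subspace $\mathcal{F}\subset\mathcal{H}$ with $\dim\mathcal{F}=\tfrac12\dim\mathcal{H}$, an operator $B$ on $\mathcal{F}$ and a unitary (surjective linear isometry) $V:\mathcal{F}\to\mathcal{F}^{\perp}$ such that $A_{\mathcal{F}}=B$ and $V^{*}A_{\mathcal{F}^{\perp}}V=B$; that is, the compressions of $A$ to $\mathcal{F}$ and to $\mathcal{F}^{\perp}$ are unitarily equivalent.
   Context: For an operator $A$ on a Hilbert space $\mathcal{H}$ and a subspace $\mathcal{E}\subset\mathcal{H}$ with orthogonal projection $E$ onto $\mathcal{E}$, the compression $A_{\mathcal{E}}$ is the operator on $\mathcal{E}$ obtained by restricting $EA$ to $\mathcal{E}$. If $\dim\mathcal{H}$ is finite and even, an orthogonal decomposition $\mathcal{H}=\mathcal{F}\oplus\mathcal{F}^{\perp}$ is called a halving decomposition if $\dim\mathcal{F}=\tfrac12\dim\mathcal{H}$. *)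

theory Defs
  imports "HOL-Analysis.Analysis" "Jordan_Normal_Form.Conjugate"
begin

text \<open>
  Finite-dimensional inner product spaces over \<^typ>\<open>real\<close> or \<^typ>\<open>complex\<close>, treated uniformly.
  On \<^typ>\<open>real\<close> the function \<^const>\<open>conjugate\<close> is the identity, on \<^typ>\<open>complex\<close> it is \<^const>\<open>cnj\<close>.
  The order on \<^typ>\<open>complex\<close> is the one in which a number is positive iff it is a positive real.
  No completeness axiom is needed, since finite-dimensional spaces are complete.
  The inner product is linear in its first argument.
\<close>

locale fd_hilbert = vector_space scale
  for scale :: "'k::{conjugatable_ordered_field, real_normed_field} \<Rightarrow> 'v::ab_group_add \<Rightarrow> 'v" +
  fixes ip :: "'v \<Rightarrow> 'v \<Rightarrow> 'k"
  assumes ip_add_left: "ip (x + y) z = ip x z + ip y z"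
    and ip_scale_left: "ip (scale c x) y = c * ip x y"
    and ip_conjugate: "ip y x = conjugate (ip x y)"
    and ip_pos: "x \<noteq> 0 \<Longrightarrow> 0 < ip x x"
    and finite_dim: "\<exists>S. finite S \<and> span S = UNIV"
begin

definition hnorm :: "'v \<Rightarrow> real" where
  "hnorm x = sqrt (norm (ip x x))"

definition perp :: "'v set \<Rightarrow> 'v set" where
  "perp E = {x. \<forall>y\<in>E. ip x y = 0}"

definition proj :: "'v set \<Rightarrow> 'v \<Rightarrow> 'v" where
  "proj E x = (THE y. y \<in> E \<and> x - y \<in> perp E)"

definition compression :: "'v set \<Rightarrow> ('v \<Rightarrow> 'v) \<Rightarrow> 'v \<Rightarrow> 'v" where
  "compression E A = restrict (\<lambda>x. proj E (A x)) E"

definition halving :: "'v set \<Rightarrow> bool" where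
  "halving F \<longleftrightarrow> subspace F \<and> 2 * dim F = dim UNIV"

text \<open>
  Maps between subspaces are represented by functions on the whole type, of which only the values
  on the subspace \<open>E\<close> matter.
\<close>

definition linear_between :: "'v set \<Rightarrow> 'v set \<Rightarrow> ('v \<Rightarrow> 'v) \<Rightarrow> bool" where
  "linear_between E G T \<longleftrightarrow> T \<in> E \<rightarrow> G \<and>
     (\<forall>x\<in>E. \<forall>y\<in>E. T (x + y) = T x + T y) \<and> (\<forall>c. \<forall>x\<in>E. T (scale c x) = scale c (T x))"

definition unitary_between :: "'v set \<Rightarrow> 'v set \<Rightarrow> ('v \<Rightarrow> 'v) \<Rightarrow> bool" where
  "unitary_between E G V \<longleftrightarrow> linear_between E G V \<and> (\<forall>x\<in>E. hnorm (V x) = hnorm x) \<and> V ` E = G"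

definition adjoint_on :: "'v set \<Rightarrow> ('v \<Rightarrow> 'v) \<Rightarrow> 'v \<Rightarrow> 'v" where
  "adjoint_on E V y = (THE z. z \<in> E \<and> (\<forall>x\<in>E. ip (V x) y = ip x z))"

end

lemma fd_hilbert_euclidean_space:
  "fd_hilbert (scaleR :: real \<Rightarrow> 'a \<Rightarrow> 'a::euclidean_space) (\<bullet>)"
proof unfold_locales
  show "\<exists>S::'a set. finite S \<and> module.span scaleR S = UNIV"
    using span_Basis finite_Basis unfolding span_raw_def by blast
qed (auto simp: algebra_simps inner_commute)

lemma fd_hilbert_complex_vec:
  "fd_hilbert ((*s) :: complex \<Rightarrow> complex^'n \<Rightarrow> complex^'n) (\<lambda>x y. \<Sum>i\<in>UNIV. x $ i * cnj (y $ i))"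
proof unfold_locales
  show "\<exists>S::(complex^'n) set. finite S \<and> module.span (*s) S = UNIV"
    using vec.finite_Basis vec.span_Basis by blast
next
  fix x :: "complex^'n" assume "x \<noteq> 0"
  then obtain j where j: "x $ j \<noteq> 0" by (auto simp: vec_eq_iff)
  have "0 < (\<Sum>i\<in>UNIV. (cmod (x $ i))\<^sup>2)"
    using j by (intro sum_pos2[of _ j]) auto
  moreover have "(\<Sum>i\<in>UNIV. x $ i * cnj (x $ i)) = complex_of_real (\<Sum>i\<in>UNIV. (cmod (x $ i))\<^sup>2)"
    by (simp only: of_real_sum complex_norm_square)
  ultimately show "0 < (\<Sum>i\<in>UNIV. x $ i * cnj (x $ i))"
    by (simp add: less_complex_def)
qed (auto simp: algebra_simps sum.distrib sum_distrib_left)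

end

theory Submission
  imports Defs "HOL-Computational_Algebra.Fundamental_Theorem_Algebra"
begin

text \<open>
  Let \<open>dim H = 2n\<close>. Diagonalise the self-adjoint operator \<open>A + A\<^sup>*\<close> and let \<open>E\<close> and \<open>G\<close> be spanned by
  the first and the last \<open>n\<close> eigenvectors, so that \<open>\<langle>A e, g\<rangle> + \<langle>e, A g\<rangle> = 0\<close> for \<open>e \<in> E\<close>, \<open>g \<in> G\<close>.
  The singular value decomposition of the block \<open>G \<rightarrow> E\<close> of \<open>A\<close> gives orthonormal bases \<open>e\<^sub>i\<close> and \<open>g\<^sub>i\<close>
  of \<open>E\<close> and \<open>G\<close> for which this block is a real diagonal matrix; hence
  \<open>\<langle>A e\<^sub>i, g\<^sub>j\<rangle> + \<langle>A g\<^sub>i, e\<^sub>j\<rangle> = 0\<close> for all \<open>i\<close>, \<open>j\<close>. This says precisely that \<open>x\<^sub>i = (e\<^sub>i + g\<^sub>i) / \<surd>2\<close> and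
  \<open>y\<^sub>i = (e\<^sub>i - g\<^sub>i) / \<surd>2\<close> satisfy \<open>\<langle>A x\<^sub>i, x\<^sub>j\<rangle> = \<langle>A y\<^sub>i, y\<^sub>j\<rangle>\<close>. Take \<open>F\<close> to be the span of the \<open>x\<^sub>i\<close> and
  \<open>V x\<^sub>i = y\<^sub>i\<close>.
\<close>

section \<open>Inner products and polynomials in an operator\<close>

context fd_hilbert
begin

lemma ip_zero_left [simp]: "ip 0 y = 0"
  using ip_scale_left[of 0 0 y] by simp

lemma ip_zero_right [simp]: "ip x 0 = 0"
  by (metis conjugate_zero ip_conjugate ip_zero_left)

lemma ip_add_right: "ip x (y + z) = ip x y + ip x z"
  by (metis conjugate_dist_add ip_add_left ip_conjugate)

lemma ip_scale_right: "ip x (scale c y) = conjugate c * ip x y"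
  by (metis conjugate_dist_mul ip_scale_left ip_conjugate)

lemma ip_minus_left: "ip (- x) y = - ip x y"
  using ip_scale_left[of "- 1" x y] by simp

lemma ip_minus_right: "ip x (- y) = - ip x y"
  by (metis conjugate_neg ip_minus_left ip_conjugate)

lemma ip_diff_left: "ip (x - y) z = ip x z - ip y z"
  using ip_add_left[of x "- y" z] by (simp add: ip_minus_left)

lemma ip_diff_right: "ip x (y - z) = ip x y - ip x z"
  using ip_add_right[of x y "- z"] by (simp add: ip_minus_right)

lemma ip_sum_left: "ip (\<Sum>i\<in>I. f i) y = (\<Sum>i\<in>I. ip (f i) y)"
  by (induction I rule: infinite_finite_induct) (auto simp: ip_add_left)

lemma ip_sum_right: "ip x (\<Sum>i\<in>I. f i) = (\<Sum>i\<in>I. ip x (f i))"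
  by (induction I rule: infinite_finite_induct) (auto simp: ip_add_right)

lemma ip_self_eq_0_iff [simp]: "ip x x = 0 \<longleftrightarrow> x = 0"
  using ip_pos[of x] by (cases "x = 0") auto

lemma ip_eq_0_commute: "ip x y = 0 \<longleftrightarrow> ip y x = 0"
  by (metis conjugate_zero_iff ip_conjugate)

lemma subspace_perp: "subspace (perp E)"
  by (auto simp: subspace_def perp_def ip_add_left ip_scale_left)

lemma perp_disjoint: "x \<in> E \<Longrightarrow> x \<in> perp E \<Longrightarrow> x = 0"
  by (auto simp: perp_def)

lemma mem_perp_span:
  assumes "\<And>b. b \<in> B \<Longrightarrow> ip x b = 0"
  shows "x \<in> perp (span B)"
proof -
  have "ip x y = 0" if "y \<in> span B" for y
    using that
    by (induction rule: span_induct_alt) (auto simp: ip_add_right ip_scale_right assms)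
  then show ?thesis by (simp add: perp_def)
qed

text \<open>Two candidates for the projection differ by a vector lying in both \<open>E\<close> and
  \<open>perp E\<close>, hence by 0. This is what makes the definite description in
  \<open>proj\<close> computable.\<close>

lemma proj_eqI:
  assumes "subspace E" "y \<in> E" "x - y \<in> perp E"
  shows "proj E x = y"
  unfolding proj_def
proof (rule the_equality)
  fix z assume z: "z \<in> E \<and> x - z \<in> perp E"
  have "z - y = (x - y) - (x - z)" by simp
  then have "z - y \<in> perp E" using subspace_diff[OF subspace_perp] assms z by metis
  moreover have "z - y \<in> E" using z assms subspace_diff by blast
  ultimately show "z = y" using perp_disjoint by fastforce
qed (use assms in auto)

text \<open>Trims the finite spanning set to a basis, so that the dimension theory of
  \<open>finite_dimensional_vector_space\<close> can be interpreted locally.\<close>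

lemma finite_dimensional: obtains B where "finite_dimensional_vector_space scale B"
proof -
  obtain S where S: "finite S" "span S = UNIV" using finite_dim by blast
  obtain B where B: "B \<subseteq> S" "independent B" "S \<subseteq> span B"
    using maximal_independent_subset by blast
  have "span B = UNIV"
    using B S by (metis span_mono span_span top.extremum_uniqueI)
  then have "finite_dimensional_vector_space scale B"
    using B S finite_subset
    by (simp add: finite_dimensional_vector_space_def vector_space_axioms
        finite_dimensional_vector_space_axioms_def)
  then show thesis by (rule that)
qed

lemma dim_less:
  assumes "subspace S" "subspace T" "S \<subset> T"
  shows "dim S < dim T"
proof -
  obtain B where "finite_dimensional_vector_space scale B" by (rule finite_dimensional)
  then interpret finite_dimensional_vector_space scale B .
  show ?thesis using assms dim_psubset[of S T] by (metis span_eq_iff)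
qed

section \<open>Linear maps and polynomials in an operator\<close>

lemma linear_comp:
  "Vector_Spaces.linear scale scale f \<Longrightarrow> Vector_Spaces.linear scale scale g \<Longrightarrow>
    Vector_Spaces.linear scale scale (g \<circ> f)"
  by (rule Vector_Spaces.linear_compose)

lemma linearI:
  assumes "\<And>x y. T (x + y) = T x + T y" "\<And>c x. T (scale c x) = scale c (T x)"
  shows "Vector_Spaces.linear scale scale T"
  using assms by (simp add: Vector_Spaces.linear_iff vector_space_axioms)

text \<open>The vector p(M) x, evaluated by Horner's scheme.\<close>

definition poly_op :: "('v \<Rightarrow> 'v) \<Rightarrow> 'k poly \<Rightarrow> 'v \<Rightarrow> 'v" where
  "poly_op M p x = fold_coeffs (\<lambda>a y. scale a x + M y) p 0"

lemma poly_op_0 [simp]: "poly_op M 0 x = 0"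
  by (simp add: poly_op_def)

context
  fixes M assumes linear: "Vector_Spaces.linear scale scale M"
begin

interpretation M: Vector_Spaces.linear scale scale M by (rule linear)

text \<open>If \<open>a\<close> and \<open>p\<close> both vanish, the fold makes no step; there
  \<open>M 0 = 0\<close> supplies the equation.\<close>

lemma poly_op_pCons [simp]: "poly_op M (pCons a p) x = scale a x + M (poly_op M p x)"
  by (cases "p = 0 \<and> a = 0") (auto simp: poly_op_def M.zero)

lemma poly_op_add: "poly_op M (p + q) x = poly_op M p x + poly_op M q x"
proof (induction p arbitrary: q rule: pCons_induct)
  case (pCons a p)
  then show ?case
    by (cases q) (simp add: M.add scale_left_distrib)
qed simp

lemma poly_op_smult: "poly_op M (smult c p) x = scale c (poly_op M p x)"
  by (induction p rule: pCons_induct) (simp_all add: M.scale scale_right_distrib)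

lemma poly_op_mult: "poly_op M (p * q) x = poly_op M p (poly_op M q x)"
  by (induction p rule: pCons_induct) (simp_all add: poly_op_add poly_op_smult)

lemma poly_op_monom: "poly_op M (monom c i) x = scale c ((M ^^ i) x)"
  by (induction i) (simp_all add: monom_Suc monom_0 M.scale M.zero)

lemma poly_op_sum: "poly_op M (\<Sum>i\<in>I. f i) x = (\<Sum>i\<in>I. poly_op M (f i) x)"
  by (induction I rule: infinite_finite_induct) (auto simp: poly_op_add)

lemma poly_op_mem:
  assumes "subspace S" "M ` S \<subseteq> S" "x \<in> S"
  shows "poly_op M p x \<in> S"
  by (induction p rule: pCons_induct)
    (use assms in \<open>auto intro!: subspace_add subspace_scale simp: subspace_0\<close>)

text \<open>The first \<open>dim UNIV + 1\<close> iterates of \<open>x\<close> under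
  \<open>M\<close> are too many to be independent, and a dependence relation lists the coefficients
  of \<open>p\<close>.\<close>

lemma annihilating_poly: obtains p where "p \<noteq> 0" "poly_op M p x = 0"
proof -
  obtain B where "finite_dimensional_vector_space scale B" by (rule finite_dimensional)
  then interpret finite_dimensional_vector_space scale B .
  define f where "f i = (M ^^ i) x" for i
  define N where "N = dim UNIV"
  show thesis
  \<comment> \<open>Dependence concerns the set of iterates, which has the required size only if
    they are distinct. If two coincide, the difference of the corresponding monomials annihilates
    \<open>x\<close>.\<close>
  proof (cases "inj_on f {..N}")
    case True
    then have "card (f ` {..N}) = Suc N" by (simp add: card_image)
    then have "dependent (f ` {..N})"
      using independent_card_le_dim[of "f ` {..N}" UNIV] by (auto simp: N_def)
    then obtain u v where u: "v \<in> f ` {..N}" "u v \<noteq> 0" "(\<Sum>v\<in>f ` {..N}. scale (u v) v) = 0"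
      by (auto simp: dependent_finite)
    then obtain k where k: "k \<le> N" "v = f k" by auto
    define p where "p = (\<Sum>i\<le>N. monom (u (f i)) i)"
    have "coeff p k = u (f k)"
      using k by (simp add: p_def coeff_sum)
    then have "p \<noteq> 0" using u k by auto
    moreover have "poly_op M p x = 0"
      using u(3) sum.reindex[OF True, of "\<lambda>v. scale (u v) v"]
      by (simp add: p_def poly_op_sum poly_op_monom f_def[symmetric])
    ultimately show thesis by (rule that)
  next
    case False
    then obtain i j where ij: "i \<noteq> j" "f i = f j" by (auto simp: inj_on_def)
    define p :: "'k poly" where "p = monom 1 i + monom (- 1) j"
    have "coeff p i = 1" using ij by (simp add: p_def)
    then have "p \<noteq> 0" by auto
    moreover have "poly_op M p x = 0"
      using ij by (simp add: p_def poly_op_add poly_op_monom f_def)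
    ultimately show thesis by (rule that)
  qed
qed

end

section \<open>Orthonormal bases\<close>

text \<open>Indexing by naturals pairs the i-th vectors of two bases and lets
  \<open>case_nat\<close> prepend a vector. Values from \<open>n\<close> on are ignored, and
  \<open>n = 0\<close> describes the zero subspace.\<close>

definition orthonormal_basis :: "(nat \<Rightarrow> 'v) \<Rightarrow> nat \<Rightarrow> 'v set \<Rightarrow> bool" where
  "orthonormal_basis e n S \<longleftrightarrow>
     (\<forall>i<n. \<forall>j<n. ip (e i) (e j) = (if i = j then 1 else 0)) \<and> span (e ` {..<n}) = S"

text \<open>For orthonormal families this is the partial isometry that carries \<open>e i\<close> to
  \<open>f i\<close> and annihilates the orthogonal complement of the \<open>e i\<close>.\<close>

definition basis_map :: "(nat \<Rightarrow> 'v) \<Rightarrow> (nat \<Rightarrow> 'v) \<Rightarrow> nat \<Rightarrow> 'v \<Rightarrow> 'v" where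
  "basis_map e f n x = (\<Sum>i<n. scale (ip x (e i)) (f i))"

abbreviation orthoproj :: "(nat \<Rightarrow> 'v) \<Rightarrow> nat \<Rightarrow> 'v \<Rightarrow> 'v" where
  "orthoproj e \<equiv> basis_map e e"

lemma linear_basis_map: "Vector_Spaces.linear scale scale (basis_map e f n)"
  by (intro linearI)
    (simp_all add: basis_map_def ip_add_left ip_scale_left scale_left_distrib sum.distrib scale_sum_right)

text \<open>Both sides are the sum of \<open>ip x (e i) * ip (f i) y\<close>. Thus swapping the
  families gives the adjoint, and \<open>orthoproj\<close> is self-adjoint.\<close>

lemma ip_basis_map: "ip (basis_map e f n x) y = ip x (basis_map f e n y)"
  by (simp add: basis_map_def ip_sum_left ip_sum_right ip_scale_left ip_scale_right
      ip_conjugate[symmetric] mult.commute)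

lemma orthonormal_basis_subspace: "orthonormal_basis e n S \<Longrightarrow> subspace S"
  by (auto simp: orthonormal_basis_def)

lemma orthonormal_basis_mem: "orthonormal_basis e n S \<Longrightarrow> i < n \<Longrightarrow> e i \<in> S"
  by (auto simp: orthonormal_basis_def intro: span_base)

lemma orthonormal_basis_ip:
  "orthonormal_basis e n S \<Longrightarrow> i < n \<Longrightarrow> j < n \<Longrightarrow> ip (e i) (e j) = (if i = j then 1 else 0)"
  by (auto simp: orthonormal_basis_def)

lemma orthonormal_basis_perp:
  assumes "orthonormal_basis e n S" "\<And>i. i < n \<Longrightarrow> ip x (e i) = 0"
  shows "x \<in> perp S"
  using mem_perp_span[of "e ` {..<n}" x] assms by (auto simp: orthonormal_basis_def)

lemma basis_map_mem: "orthonormal_basis f n S \<Longrightarrow> basis_map e f n x \<in> S"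
  unfolding basis_map_def
  by (intro subspace_sum subspace_scale) (auto intro: orthonormal_basis_subspace orthonormal_basis_mem)

lemma basis_map_ip:
  assumes "orthonormal_basis f n S" "j < n"
  shows "ip (basis_map e f n x) (f j) = ip x (e j)"
proof -
  have "ip (basis_map e f n x) (f j) = (\<Sum>i<n. if i = j then ip x (e i) else 0)"
    unfolding basis_map_def ip_sum_left ip_scale_left
    by (intro sum.cong) (use assms in \<open>auto simp: orthonormal_basis_ip\<close>)
  then show ?thesis using assms by simp
qed

text \<open>The coordinates of \<open>basis_map e f n x\<close> along \<open>f\<close> are those of
  \<open>x\<close> along \<open>e\<close>. With \<open>h = e\<close> this turns into inverse and
  isometry properties.\<close>

lemma basis_map_comp:
  assumes "orthonormal_basis f n S"
  shows "basis_map f h n (basis_map e f n x) = basis_map e h n x"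
  unfolding basis_map_def[of f h] using assms by (simp add: basis_map_ip) (simp add: basis_map_def)

lemma diff_orthoproj:
  assumes "orthonormal_basis e n S"
  shows "x - orthoproj e n x \<in> perp S"
  by (rule orthonormal_basis_perp[OF assms]) (use assms in \<open>simp add: basis_map_ip ip_diff_left\<close>)

lemma ip_orthoproj_left:
  assumes "orthonormal_basis e n S" "y \<in> S"
  shows "ip (orthoproj e n x) y = ip x y"
  using diff_orthoproj[OF assms(1), of x] assms(2) by (simp add: perp_def ip_diff_left)

lemma proj_eq_orthoproj:
  assumes "orthonormal_basis e n S"
  shows "proj S x = orthoproj e n x"
  using assms by (intro proj_eqI orthonormal_basis_subspace basis_map_mem diff_orthoproj)

lemma orthoproj_eq:
  assumes "orthonormal_basis e n S" "x \<in> S"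
  shows "orthoproj e n x = x"
proof -
  have "proj S x = x"
    using assms subspace_0[OF subspace_perp] by (intro proj_eqI orthonormal_basis_subspace) auto
  then show ?thesis using proj_eq_orthoproj[OF assms(1)] by simp
qed

lemma orthonormal_basis_inj: "orthonormal_basis e n S \<Longrightarrow> inj_on e {..<n}"
  by (rule inj_onI) (metis lessThan_iff orthonormal_basis_ip zero_neq_one)

lemma orthonormal_basis_dim:
  assumes "orthonormal_basis e n S"
  shows "dim S = n"
proof -
  note inj = orthonormal_basis_inj[OF assms]
  have "independent (e ` {..<n})"
  proof (rule independent_if_scalars_zero)
    fix f x assume 0: "(\<Sum>x\<in>e ` {..<n}. scale (f x) x) = 0" and "x \<in> e ` {..<n}"
    then obtain j where j: "j < n" "x = e j" by auto
    have "0 = ip (\<Sum>i<n. scale (f (e i)) (e i)) (e j)"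
      using 0 inj by (simp add: sum.reindex)
    also have "\<dots> = (\<Sum>i<n. if i = j then f (e i) else 0)"
      unfolding ip_sum_left ip_scale_left
      by (intro sum.cong) (use assms j in \<open>auto simp: orthonormal_basis_ip\<close>)
    finally show "f x = 0" using j by simp
  qed simp
  then have "dim (span (e ` {..<n})) = card (e ` {..<n})"
    by (rule dim_span_eq_card_independent)
  then show ?thesis
    using assms inj unfolding orthonormal_basis_def by (simp add: card_image del: dim_span)
qed

lemma perp_singleton: "x \<in> perp {y} \<longleftrightarrow> ip x y = 0"
  by (simp add: perp_def)

text \<open>Subtracting \<open>scale (ip x u) u\<close> moves a vector of \<open>S\<close> into the
  orthogonal complement of \<open>u\<close>. The inductions for the spectral theorem and for the
  singular values both extend their bases this way.\<close>

lemma orthonormal_basis_Suc: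
  assumes "subspace S" "u \<in> S" "ip u u = 1" "orthonormal_basis e n (S \<inter> perp {u})"
  shows "orthonormal_basis (case_nat u e) (Suc n) S"
proof -
  have img: "case_nat u e ` {..<Suc n} = insert u (e ` {..<n})"
    by (simp add: lessThan_Suc_eq_insert_0 image_image)
  have e: "e i \<in> S" "ip (e i) u = 0" if "i < n" for i
    using orthonormal_basis_mem[OF assms(4) that] by (auto simp: perp_singleton)
  have "span (insert u (e ` {..<n})) = S"
  proof
    show "span (insert u (e ` {..<n})) \<subseteq> S"
      using assms e by (intro span_minimal) auto
    show "S \<subseteq> span (insert u (e ` {..<n}))"
    proof
      fix x assume x: "x \<in> S"
      have "x - scale (ip x u) u \<in> S \<inter> perp {u}"
        using x assms
        by (auto intro: subspace_diff subspace_scale simp: perp_singleton ip_diff_left ip_scale_left)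
      then show "x \<in> span (insert u (e ` {..<n}))"
        using assms(4) by (auto simp: span_insert orthonormal_basis_def)
    qed
  qed
  moreover have "ip u (e i) = 0" if "i < n" for i
    using e(2)[OF that] ip_eq_0_commute by blast
  ultimately show ?thesis
    using assms(3,4) e
    by (auto simp: orthonormal_basis_def img split: nat.split)
qed

end

section \<open>Spectral theorem and singular values\<close>

text \<open>
  The scalar field is left abstract; the assumptions are the only properties of the real and
  complex numbers that the argument uses.
\<close>

locale spectral_space = fd_hilbert scale ip
  for scale :: "'k::{conjugatable_ordered_field, real_normed_field} \<Rightarrow> 'v::ab_group_add \<Rightarrow> 'v"
    and ip +
  assumes pos_eq_norm: "0 < (a::'k) \<Longrightarrow> a = of_real (norm a)"
    and conjugate_of_real: "conjugate (of_real r :: 'k) = of_real r"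
    and selfadjoint_eigenvector:
      "Vector_Spaces.linear scale scale M \<Longrightarrow> subspace S \<Longrightarrow> M ` S \<subseteq> S \<Longrightarrow>
        (\<And>x y. x \<in> S \<Longrightarrow> y \<in> S \<Longrightarrow> ip (M x) y = ip x (M y)) \<Longrightarrow> S \<noteq> {0} \<Longrightarrow>
        \<exists>x\<in>S. x \<noteq> 0 \<and> (\<exists>c. M x = scale c x)"
begin

lemma ip_self: "ip x x = of_real ((hnorm x)\<^sup>2)"
  using pos_eq_norm[OF ip_pos[of x]] by (cases "x = 0") (auto simp: hnorm_def)

lemma hnorm_eq_0_iff [simp]: "hnorm x = 0 \<longleftrightarrow> x = 0"
  by (simp add: hnorm_def)

lemma normalize:
  assumes "x \<noteq> 0"
  shows "ip (scale (of_real (1 / hnorm x)) x) (scale (of_real (1 / hnorm x)) x) = 1"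
proof -
  have "1 / hnorm x * (1 / hnorm x * (hnorm x)\<^sup>2) = 1"
    using assms by (simp add: power2_eq_square)
  then show ?thesis
    unfolding ip_scale_left ip_scale_right conjugate_of_real ip_self[of x] of_real_mult[symmetric]
    by (simp only: of_real_1)
qed

text \<open>Induction on the dimension: split off a unit eigenvector \<open>u\<close> and continue
  in its orthogonal complement within \<open>S\<close>.\<close>

theorem selfadjoint_diagonal:
  assumes "Vector_Spaces.linear scale scale M" "subspace S" "M ` S \<subseteq> S"
    and "\<And>x y. x \<in> S \<Longrightarrow> y \<in> S \<Longrightarrow> ip (M x) y = ip x (M y)"
  shows "\<exists>e n. orthonormal_basis e n S \<and> (\<forall>i<n. \<exists>c. M (e i) = scale c (e i))"
  using assms(2-)
proof (induction "dim S" arbitrary: S rule: less_induct)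
  case less
  interpret M: Vector_Spaces.linear scale scale M by (rule assms(1))
  show ?case
  proof (cases "S = {0}")
    case True
    then have "orthonormal_basis (\<lambda>_. 0) 0 S" by (simp add: orthonormal_basis_def)
    then show ?thesis by blast
  next
    case False
    obtain x c where x: "x \<in> S" "x \<noteq> 0" "M x = scale c x"
      using selfadjoint_eigenvector[OF assms(1) less.prems False] by blast
    define u where "u = scale (of_real (1 / hnorm x)) x"
    have u: "u \<in> S" "ip u u = 1" "M u = scale c u"
      using x less.prems(1) normalize[OF x(2)]
      by (auto simp: u_def M.scale subspace_scale scale_left_commute)
    let ?T = "S \<inter> perp {u}"
    have sub: "subspace ?T" by (simp add: less.prems(1) subspace_inter subspace_perp)
    have "u \<notin> ?T" using u by (simp add: perp_singleton)
    then have dim: "dim ?T < dim S" using u less.prems(1) sub by (intro dim_less) auto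
    \<comment> \<open>For \<open>x\<close> in \<open>S\<close> orthogonal to \<open>u\<close>,
      \<open>ip (M x) u = ip x (M u)\<close> is a multiple of \<open>ip x u = 0\<close>, so the
      complement is invariant.\<close>
    have inv: "M ` ?T \<subseteq> ?T"
      using less.prems u by (auto simp: perp_singleton ip_scale_right)
    obtain e n where e: "orthonormal_basis e n ?T" "\<forall>i<n. \<exists>c. M (e i) = scale c (e i)"
      using less.hyps[OF dim sub inv] less.prems(3) by blast
    have "orthonormal_basis (case_nat u e) (Suc n) S"
      by (rule orthonormal_basis_Suc[OF less.prems(1) u(1,2) e(1)])
    moreover have "\<forall>i<Suc n. \<exists>c. M (case_nat u e i) = scale c (case_nat u e i)"
      using e u by (auto split: nat.split)
    ultimately show ?thesis by blast
  qed
qed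

text \<open>The identity is self-adjoint, so diagonalising it yields an orthonormal basis.\<close>

corollary orthonormal_basis_exists:
  assumes "subspace S"
  obtains e where "orthonormal_basis e (dim S) S"
proof -
  have "Vector_Spaces.linear scale scale (\<lambda>x. x)" by (intro linearI) auto
  then obtain e n where "orthonormal_basis e n S"
    using selfadjoint_diagonal[of "\<lambda>x. x" S] assms by auto
  then show thesis using that orthonormal_basis_dim by metis
qed

text \<open>Expanding \<open>x\<close> in an orthonormal basis \<open>b\<close> of the whole space
  dictates the coefficient \<open>ip y (A (b i))\<close> of \<open>A' y\<close> at
  \<open>b i\<close>.\<close>

lemma adjoint_exists:
  assumes "Vector_Spaces.linear scale scale A"
  obtains A' where "Vector_Spaces.linear scale scale A'" "\<And>x y. ip (A x) y = ip x (A' y)"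
proof -
  interpret A: Vector_Spaces.linear scale scale A by (rule assms)
  obtain b n where b: "orthonormal_basis b n UNIV"
    using orthonormal_basis_exists[OF subspace_UNIV] by metis
  define A' where "A' y = (\<Sum>i<n. scale (ip y (A (b i))) (b i))" for y
  have "ip (A x) y = ip x (A' y)" for x y
  proof -
    have "ip (A x) y = ip (A (orthoproj b n x)) y" using orthoproj_eq[OF b] by simp
    also have "\<dots> = ip x (A' y)"
      by (simp add: basis_map_def A.sum A.scale A'_def ip_sum_left ip_sum_right ip_scale_left
          ip_scale_right ip_conjugate[symmetric] mult.commute)
    finally show ?thesis .
  qed
  moreover have "Vector_Spaces.linear scale scale A'"
    by (intro linearI)
      (simp_all add: A'_def ip_add_left ip_scale_left scale_left_distrib sum.distrib scale_sum_right)
  ultimately show thesis using that by blast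
qed

text \<open>Let T be the block of \<open>A\<close> from \<open>G\<close> to \<open>E\<close>.
  Induction on \<open>n\<close>: an eigenvector of (adjoint of T) T that T does not kill, together
  with its normalised image, forms a singular pair; what remains is a block between the two
  orthogonal complements.\<close>

theorem singular_value_bases:
  assumes A: "Vector_Spaces.linear scale scale A"
    and "orthonormal_basis e n E" "orthonormal_basis g n G"
  shows "\<exists>e g s. orthonormal_basis e n E \<and> orthonormal_basis g n G \<and>
    (\<forall>i<n. \<forall>j<n. ip (A (g i)) (e j) = (if i = j then of_real (s i) else 0))"
  using assms(2,3)
proof (induction n arbitrary: e g E G)
  case 0
  then show ?case by auto
next
  case (Suc n)
  interpret A: Vector_Spaces.linear scale scale A by (rule A)
  note subE = orthonormal_basis_subspace[OF Suc.prems(1)]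
  note subG = orthonormal_basis_subspace[OF Suc.prems(2)]
  define P where "P = orthoproj e (Suc n)"
  define R where "R = orthoproj g (Suc n)"
  show ?case
  proof (cases "\<forall>x\<in>G. P (A x) = 0")
    case True
    have "ip (A (g i)) (e j) = 0" if "i < Suc n" "j < Suc n" for i j
      using ip_orthoproj_left[OF Suc.prems(1), of "e j" "A (g i)"] True that Suc.prems
      by (simp add: P_def orthonormal_basis_mem)
    then show ?thesis
      using Suc.prems by (intro exI[of _ e] exI[of _ g] exI[of _ "\<lambda>_. 0"]) auto
  next
    case False
    obtain A' where A': "Vector_Spaces.linear scale scale A'" "\<And>x y. ip (A x) y = ip x (A' y)"
      using adjoint_exists[OF A] by blast
    \<comment> \<open>On \<open>G\<close>, where T is \<open>P \<circ> A\<close>, this is T followed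
      by its adjoint.\<close>
    define M where "M = R \<circ> (A' \<circ> (P \<circ> A))"
    have lin: "Vector_Spaces.linear scale scale M"
      unfolding M_def P_def R_def
      by (intro linear_comp linear_basis_map A A'(1))
    have M: "ip x (M y) = ip (P (A x)) (P (A y))" if "x \<in> G" for x y
    proof -
      have "ip x (M y) = ip (R x) (A' (P (A y)))"
        by (simp add: M_def R_def ip_basis_map)
      also have "R x = x" using orthoproj_eq[OF Suc.prems(2) that] by (simp add: R_def)
      also have "ip x (A' (P (A y))) = ip (A x) (P (A y))" by (simp add: A'(2))
      also have "\<dots> = ip (P (A x)) (P (A y))"
        using ip_orthoproj_left[OF Suc.prems(1)] basis_map_mem[OF Suc.prems(1)]
        by (simp add: P_def)
      finally show ?thesis .
    qed
    have MG: "M ` G \<subseteq> G" using basis_map_mem[OF Suc.prems(2)] by (auto simp: M_def R_def)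
    have sa: "ip (M x) y = ip x (M y)" if "x \<in> G" "y \<in> G" for x y
      using M[OF that(1), of y] M[OF that(2), of x] by (metis ip_conjugate)
    obtain h m where h: "orthonormal_basis h m G" "\<forall>i<m. \<exists>c. M (h i) = scale c (h i)"
      using selfadjoint_diagonal[OF lin subG MG sa] by blast
    \<comment> \<open>The eigenvectors span \<open>G\<close>, so T would vanish on \<open>G\<close>
      if it killed all of them.\<close>
    have "\<exists>i<m. P (A (h i)) \<noteq> 0"
    proof (rule ccontr)
      interpret PA: Vector_Spaces.linear scale scale "P \<circ> A"
        unfolding P_def by (intro linear_comp linear_basis_map A)
      assume "\<not> (\<exists>i<m. P (A (h i)) \<noteq> 0)"
      then have "(P \<circ> A) (orthoproj h m x) = 0" for x
        by (simp only: basis_map_def PA.sum PA.scale) simp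
      then have "P (A x) = 0" if "x \<in> G" for x
        using orthoproj_eq[OF h(1) that] by (metis comp_apply)
      then show False using False by blast
    qed
    then obtain k where k: "k < m" "P (A (h k)) \<noteq> 0" by blast
    define w where "w = P (A (h k))"
    obtain c where c: "M (h k) = scale c (h k)" using h(2) k by blast
    define u where "u = scale (of_real (1 / hnorm w)) w"
    have w: "w \<noteq> 0" "w \<in> E" using k basis_map_mem[OF Suc.prems(1)] by (auto simp: w_def P_def)
    then have u: "u \<in> E" "ip u u = 1"
      using normalize[OF w(1)] by (auto simp: u_def subE subspace_scale)
    have wu: "w = scale (of_real (hnorm w)) u" using w by (simp add: u_def)
    have v: "h k \<in> G" "ip (h k) (h k) = 1"
      using h(1) k by (auto simp: orthonormal_basis_mem orthonormal_basis_ip)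
    \<comment> \<open>T sends \<open>h k\<close> to \<open>hnorm w\<close> times \<open>u\<close>,
      which gives the real singular value and zeros in the rest of its row.\<close>
    have Ahk: "ip (A (h k)) y = of_real (hnorm w) * ip u y" if "y \<in> E" for y
      using ip_orthoproj_left[OF Suc.prems(1) that, of "A (h k)"] wu
      by (metis P_def ip_scale_left w_def)
    \<comment> \<open>As \<open>h k\<close> is an eigenvector of \<open>M\<close>, T preserves
      orthogonality to it: \<open>ip (A x) w = ip x (M (h k)) = 0\<close>.\<close>
    have Au: "ip (A x) u = 0" if "x \<in> G \<inter> perp {h k}" for x
    proof -
      have "ip (A x) w = ip x (M (h k))"
        using M[of x "h k"] that ip_orthoproj_left[OF Suc.prems(1) w(2), of "A x"]
        by (simp add: w_def P_def)
      also have "\<dots> = 0" using that by (simp add: c ip_scale_right perp_singleton)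
      finally show ?thesis by (simp add: u_def ip_scale_right)
    qed
    have sub: "subspace (E \<inter> perp {u})" "subspace (G \<inter> perp {h k})"
      using subE subG by (auto intro: subspace_inter subspace_perp)
    obtain e1 where e1: "orthonormal_basis e1 (dim (E \<inter> perp {u})) (E \<inter> perp {u})"
      using orthonormal_basis_exists[OF sub(1)] .
    obtain g1 where g1: "orthonormal_basis g1 (dim (G \<inter> perp {h k})) (G \<inter> perp {h k})"
      using orthonormal_basis_exists[OF sub(2)] .
    \<comment> \<open>Prepending the removed vector gives back a basis of length
      \<open>Suc n\<close>, so both complements have dimension \<open>n\<close>, as the induction
      hypothesis demands.\<close>
    have "dim (E \<inter> perp {u}) = n"
      using orthonormal_basis_dim[OF orthonormal_basis_Suc[OF subE u e1]]
        orthonormal_basis_dim[OF Suc.prems(1)] by simp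
    moreover have "dim (G \<inter> perp {h k}) = n"
      using orthonormal_basis_dim[OF orthonormal_basis_Suc[OF subG v g1]]
        orthonormal_basis_dim[OF Suc.prems(2)] by simp
    ultimately obtain e2 g2 s where IH:
      "orthonormal_basis e2 n (E \<inter> perp {u})" "orthonormal_basis g2 n (G \<inter> perp {h k})"
      "\<forall>i<n. \<forall>j<n. ip (A (g2 i)) (e2 j) = (if i = j then of_real (s i) else 0)"
      using Suc.IH e1 g1 by metis
    have "ip (A (h k)) (e2 j) = 0" if "j < n" for j
      using Ahk[of "e2 j"] orthonormal_basis_mem[OF IH(1) that] ip_eq_0_commute[of u]
      by (auto simp: perp_singleton)
    moreover have "ip (A (g2 i)) u = 0" if "i < n" for i
      using Au orthonormal_basis_mem[OF IH(2) that] by blast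
    moreover have "ip (A (h k)) u = of_real (hnorm w)" using Ahk u by simp
    ultimately have "\<forall>i<Suc n. \<forall>j<Suc n. ip (A (case_nat (h k) g2 i)) (case_nat u e2 j)
        = (if i = j then of_real (case_nat (hnorm w) s i) else 0)"
      using IH(3) by (auto split: nat.split)
    then show ?thesis
      using orthonormal_basis_Suc[OF subE u IH(1)] orthonormal_basis_Suc[OF subG v IH(2)] by blast
  qed
qed

section \<open>Halving decomposition and its unitary\<close>

lemma halving_bases:
  assumes A: "Vector_Spaces.linear scale scale A" and "dim UNIV = 2 * n"
  obtains x F y where "orthonormal_basis x n F" "orthonormal_basis y n (perp F)"
    "\<And>i j. i < n \<Longrightarrow> j < n \<Longrightarrow> ip (A (x i)) (x j) = ip (A (y i)) (y j)"
proof -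
  interpret A: Vector_Spaces.linear scale scale A by (rule A)
  obtain A' where A': "Vector_Spaces.linear scale scale A'" "\<And>x y. ip (A x) y = ip x (A' y)"
    using adjoint_exists[OF A] by blast
  interpret A': Vector_Spaces.linear scale scale A' by (rule A')
  define H where "H x = A x + A' x" for x
  have lin: "Vector_Spaces.linear scale scale H"
    by (intro linearI) (simp_all add: H_def A.add A'.add A.scale A'.scale scale_right_distrib)
  interpret H: Vector_Spaces.linear scale scale H by (rule lin)
  have A'_left: "ip (A' x) y = conjugate (ip (A y) x)" for x y
    by (metis A'(2) ip_conjugate)
  have "ip (H x) y = ip x (H y)" for x y
    by (simp add: H_def ip_add_left ip_add_right A'(2) A'_left) (metis A'(2) ip_conjugate)
  then obtain b where b: "orthonormal_basis b (2 * n) UNIV" "\<forall>i<2*n. \<exists>c. H (b i) = scale c (b i)"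
    using selfadjoint_diagonal[OF lin subspace_UNIV] orthonormal_basis_dim assms(2) by (metis subset_UNIV)
  define E where "E = span (b ` {..<n})"
  define G where "G = span ((\<lambda>i. b (n + i)) ` {..<n})"
  have E: "orthonormal_basis b n E" and G: "orthonormal_basis (\<lambda>i. b (n + i)) n G"
    using b(1) by (auto simp: orthonormal_basis_def E_def G_def)
  have "x \<in> perp E" if "x \<in> (\<lambda>i. b (n + i)) ` {..<n}" for x
    unfolding E_def by (rule mem_perp_span) (use that b(1) in \<open>auto simp: orthonormal_basis_def\<close>)
  then have "G \<subseteq> perp E" unfolding G_def by (intro span_minimal subspace_perp) auto
  then have GE: "ip y x = 0" "ip x y = 0" if "x \<in> E" "y \<in> G" for x y
    using that ip_eq_0_commute by (auto simp: perp_def)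
  \<comment> \<open>Invariance of \<open>E\<close> under \<open>H\<close>, combined with
    \<open>GE\<close>, kills the block of \<open>H\<close> from \<open>E\<close> to \<open>G\<close>
    in any bases, so the eigenvectors \<open>b\<close> may be replaced by singular bases.\<close>
  have HE: "H x \<in> E" if "x \<in> E" for x
  proof -
    have "H (orthoproj b n x) \<in> E"
      unfolding basis_map_def H.sum H.scale
      using b(2) orthonormal_basis_mem[OF E] orthonormal_basis_subspace[OF E]
      by (intro subspace_sum subspace_scale) (auto, metis add_lessD1 mult_2 subspace_scale trans_less_add1)
    then show ?thesis using orthoproj_eq[OF E that] by simp
  qed
  obtain e g s where eg: "orthonormal_basis e n E" "orthonormal_basis g n G"
    "\<forall>i<n. \<forall>j<n. ip (A (g i)) (e j) = (if i = j then of_real (s i) else 0)"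
    using singular_value_bases[OF A E G] by blast
  \<comment> \<open>The vanishing block of \<open>H\<close> involves the conjugate of
    \<open>ip (A (g j)) (e i)\<close>; since that matrix is real and diagonal, conjugating and
    transposing leave it unchanged.\<close>
  have cross: "ip (A (e i)) (g j) + ip (A (g i)) (e j) = 0" if "i < n" "j < n" for i j
  proof -
    have "ip (H (e i)) (g j) = 0"
      using GE HE eg that by (auto simp: orthonormal_basis_mem)
    then have "ip (A (e i)) (g j) + conjugate (ip (A (g j)) (e i)) = 0"
      by (simp add: H_def ip_add_left A'_left)
    then show ?thesis using eg(3) that by (auto simp: conjugate_of_real split: if_splits)
  qed
  define r :: 'k where "r = of_real (1 / sqrt 2)"
  have r: "conjugate r = r" "r * r = 1 / 2"
    unfolding r_def by (rule conjugate_of_real) (simp flip: of_real_mult)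
  define x where "x i = scale r (e i + g i)" for i
  define y where "y i = scale r (e i - g i)" for i
  define F where "F = span (x ` {..<n})"
  define F' where "F' = span (y ` {..<n})"
  note ips = x_def y_def ip_scale_left ip_scale_right ip_add_left ip_add_right ip_diff_left
    ip_diff_right r(1) A.scale A.add A.diff
  have base: "ip (e i) (e j) = (if i = j then 1 else 0)" "ip (g i) (g j) = (if i = j then 1 else 0)"
    "ip (e i) (g j) = 0" "ip (g i) (e j) = 0" if "i < n" "j < n" for i j
    using eg(1,2) GE that by (auto simp: orthonormal_basis_ip orthonormal_basis_mem)
  have x: "orthonormal_basis x n F" and y: "orthonormal_basis y n F'"
    using r(2) by (auto simp: orthonormal_basis_def mult.commute[of _ 2] mult.left_commute[of r 2] F_def F'_def ips base)
  have xy: "ip (y i) (x j) = 0" if "i < n" "j < n" for i j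
    using that by (simp add: ips base)
  have "x \<in> perp F" if "x \<in> y ` {..<n}" for x
    unfolding F_def by (rule mem_perp_span) (use that xy in auto)
  then have sub: "F' \<subseteq> perp F" unfolding F'_def by (intro span_minimal subspace_perp) auto
  \<comment> \<open>As \<open>2 * r * r = 1\<close>, each \<open>e i\<close> and \<open>g i\<close>
    is recovered from \<open>x i\<close> and \<open>y i\<close>. Spanning the whole space is what
    makes \<open>F'\<close> all of \<open>perp F\<close>.\<close>
  have "UNIV \<subseteq> span (x ` {..<n} \<union> y ` {..<n})"
  proof -
    let ?S = "span (x ` {..<n} \<union> y ` {..<n})"
    have "e i \<in> ?S" "g i \<in> ?S" if "i < n" for i
    proof -
      have two: "scale (1 / 2) v + scale (1 / 2) v = v" for v
        using scale_left_distrib[of "1/2" "1/2" v] by simp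
      have "e i = scale r (x i + y i)" "g i = scale r (x i - y i)"
        using two[of "e i"] two[of "g i"]
        by (simp_all add: x_def y_def r(2) scale_right_distrib scale_right_diff_distrib)
      moreover have "x i \<in> ?S" "y i \<in> ?S" using that by (auto intro: span_base)
      ultimately show "e i \<in> ?S" "g i \<in> ?S" by (metis span_add span_diff span_scale)+
    qed
    then have "span (e ` {..<n}) \<subseteq> ?S" "span (g ` {..<n}) \<subseteq> ?S"
      by (intro span_minimal; auto)+
    then have EG: "E \<subseteq> ?S" "G \<subseteq> ?S" using eg(1,2) by (auto simp: orthonormal_basis_def)
    have "b i \<in> ?S" if "i < 2 * n" for i
    proof (cases "i < n")
      case True
      then show ?thesis using EG(1) orthonormal_basis_mem[OF E] by blast
    next
      case False
      then show ?thesis using EG(2) orthonormal_basis_mem[OF G, of "i - n"] that by auto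
    qed
    then have "span (b ` {..<2*n}) \<subseteq> ?S" by (intro span_minimal) auto
    then show ?thesis using b(1) by (simp add: orthonormal_basis_def)
  qed
  \<comment> \<open>The \<open>F\<close> component \<open>u\<close> of \<open>z\<close> also lies in
    \<open>perp F\<close>, so it vanishes.\<close>
  have "perp F \<subseteq> F'"
  proof
    fix z assume z: "z \<in> perp F"
    obtain u v where uv: "z = u + v" "u \<in> F" "v \<in> F'"
      using \<open>UNIV \<subseteq> _\<close> by (force simp: span_Un F_def F'_def)
    then have "u = z - v" by simp
    then have "u \<in> perp F" using z uv sub subspace_diff[OF subspace_perp] by blast
    then show "z \<in> F'" using uv perp_disjoint by force
  qed
  then have "F' = perp F" using sub by blast
  \<comment> \<open>After expansion the two sides differ by \<open>2 * r * r\<close> times the sum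
    in \<open>cross\<close>.\<close>
  moreover have "ip (A (x i)) (x j) = ip (A (y i)) (y j)" if "i < n" "j < n" for i j
  proof -
    have "ip (A (e i)) (g j) = - ip (A (g i)) (e j)"
      using cross[OF that] by (simp add: eq_neg_iff_add_eq_0)
    then show ?thesis by (simp add: ips algebra_simps)
  qed
  ultimately show thesis using that x y by metis
qed

text \<open>The compressions have the same matrix in the bases \<open>x\<close> and
  \<open>y\<close>, so the unitary carrying \<open>x i\<close> to \<open>y i\<close> intertwines
  them.\<close>

theorem halving_compressions:
  assumes A: "Vector_Spaces.linear scale scale A" and "even (dim UNIV)"
  shows "\<exists>F B V. halving F \<and> linear_between F F B \<and> unitary_between F (perp F) V \<and>
    (\<forall>x\<in>F. compression F A x = B x) \<and>
    (\<forall>x\<in>F. adjoint_on F V (compression (perp F) A (V x)) = B x)"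
proof -
  interpret A: Vector_Spaces.linear scale scale A by (rule A)
  obtain n where n: "dim UNIV = 2 * n" using assms(2) by (auto elim: evenE)
  obtain x F y where x: "orthonormal_basis x n F" and y: "orthonormal_basis y n (perp F)"
    and eq: "\<And>i j. i < n \<Longrightarrow> j < n \<Longrightarrow> ip (A (x i)) (x j) = ip (A (y i)) (y j)"
    by (rule halving_bases[OF A n]) blast
  define B where "B = orthoproj x n \<circ> A"
  define V where "V = basis_map x y n"
  interpret B: Vector_Spaces.linear scale scale B
    unfolding B_def by (intro linear_comp linear_basis_map A)
  interpret V: Vector_Spaces.linear scale scale V
    unfolding V_def by (rule linear_basis_map)
  have "halving F"
    using orthonormal_basis_dim[OF x] orthonormal_basis_subspace[OF x] n by (simp add: halving_def)
  moreover have "linear_between F F B"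
    using basis_map_mem[OF x] by (auto simp: linear_between_def B.add B.scale) (simp add: B_def)
  moreover have VF: "V z \<in> perp F" for z
    using basis_map_mem[OF y] by (simp add: V_def)
  moreover have "unitary_between F (perp F) V"
    unfolding unitary_between_def
  proof (intro conjI ballI)
    show "linear_between F (perp F) V" using VF by (simp add: linear_between_def V.add V.scale)
    \<comment> \<open>The adjoint of \<open>V\<close> composed with \<open>V\<close> is the
      projection onto \<open>F\<close>, which fixes \<open>z\<close>.\<close>
    show "hnorm (V z) = hnorm z" if "z \<in> F" for z
      using orthoproj_eq[OF x that] basis_map_comp[OF y]
      by (simp add: hnorm_def V_def ip_basis_map)
    have "w \<in> V ` F" if "w \<in> perp F" for w
    proof
      show "w = V (basis_map y x n w)"
        using orthoproj_eq[OF y that] basis_map_comp[OF x] by (simp add: V_def)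
      show "basis_map y x n w \<in> F" by (rule basis_map_mem[OF x])
    qed
    then show "V ` F = perp F" using VF by auto
  qed
  moreover have "\<forall>z\<in>F. compression F A z = B z"
    by (simp add: compression_def proj_eq_orthoproj[OF x] B_def)
  moreover have "adjoint_on F V (compression (perp F) A (V z)) = B z" if "z \<in> F" for z
  proof -
    \<comment> \<open>Uniqueness: the difference \<open>d\<close> of two candidates lies in
      \<open>F\<close> and may be tested against itself.\<close>
    have adj: "adjoint_on F V w = basis_map y x n w" for w
      unfolding adjoint_on_def
    proof (rule the_equality)
      show "basis_map y x n w \<in> F \<and> (\<forall>z\<in>F. ip (V z) w = ip z (basis_map y x n w))"
        by (simp add: basis_map_mem[OF x] V_def ip_basis_map)
      fix u assume u: "u \<in> F \<and> (\<forall>z\<in>F. ip (V z) w = ip z u)"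
      define d where "d = u - basis_map y x n w"
      have "d \<in> F"
        using u basis_map_mem[OF x] orthonormal_basis_subspace[OF x] by (auto simp: d_def subspace_diff)
      then have "ip d u = ip d (basis_map y x n w)"
        using u by (simp add: V_def ip_basis_map)
      then have "ip d d = 0" by (subst (2) d_def) (simp add: ip_diff_right)
      then show "u = basis_map y x n w" by (simp add: d_def)
    qed
    have Ay: "ip (A (V z)) (y j) = ip (A z) (x j)" if j: "j < n" for j
    proof -
      have "ip (A (V z)) (y j) = (\<Sum>i<n. ip z (x i) * ip (A (y i)) (y j))"
        by (simp add: V_def basis_map_def A.sum A.scale ip_sum_left ip_scale_left)
      also have "\<dots> = ip (A (orthoproj x n z)) (x j)"
        using eq j by (simp add: basis_map_def A.sum A.scale ip_sum_left ip_scale_left)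
      finally show ?thesis using orthoproj_eq[OF x \<open>z \<in> F\<close>] by simp
    qed
    \<comment> \<open>Mapping \<open>y\<close> back to \<open>x\<close> absorbs the projection onto
      \<open>perp F\<close>; \<open>Ay\<close> then matches the remaining coefficients with those of
      \<open>A z\<close> along \<open>x\<close>.\<close>
    have "adjoint_on F V (compression (perp F) A (V z)) = basis_map y x n (A (V z))"
      using VF basis_map_comp[OF y]
      by (simp add: adj compression_def proj_eq_orthoproj[OF y])
    also have "\<dots> = B z" by (simp add: B_def basis_map_def Ay)
    finally show ?thesis .
  qed
  ultimately show ?thesis by blast
qed

end

section \<open>Existence of eigenvectors over the real and complex numbers\<close>

text \<open>Descent on an annihilating polynomial of a nonzero vector: split off a root
  \<open>z\<close>. The quotient applied to the vector is an eigenvector for \<open>z\<close> unless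
  it is 0, and then the quotient itself annihilates.\<close>

lemma spectral_space_complex:
  fixes sc :: "complex \<Rightarrow> 'w::ab_group_add \<Rightarrow> 'w"
  assumes "fd_hilbert sc ip"
  shows "spectral_space sc ip"
proof -
  interpret fd_hilbert sc ip by (rule assms)
  show ?thesis
  proof
    show "a = of_real (norm a)" if "0 < a" for a :: complex
      using that by (auto simp: less_complex_def complex_eq_iff cmod_def)
    show "conjugate (of_real r :: complex) = of_real r" for r by simp
    fix M S assume M: "Vector_Spaces.linear sc sc M" and S: "subspace S" "M ` S \<subseteq> S" "S \<noteq> {0}"
    interpret M: Vector_Spaces.linear sc sc M by (rule M)
    obtain x where x: "x \<in> S" "x \<noteq> 0" using S(1,3) subspace_0 by fastforce
    obtain p where "p \<noteq> 0" "poly_op M p x = 0" using annihilating_poly[OF M] by blast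
    then show "\<exists>x\<in>S. x \<noteq> 0 \<and> (\<exists>c. M x = sc c x)"
    proof (induction "degree p" arbitrary: p rule: less_induct)
      case less
      show ?case
      proof (cases "degree p = 0")
        \<comment> \<open>A nonzero constant cannot annihilate the nonzero vector
          \<open>x\<close>.\<close>
        case True
        then obtain a where "p = [:a:]" by (rule degree_eq_zeroE)
        then show ?thesis using less.prems x by (simp add: M M.zero)
      next
        case False
        then obtain z where "poly p z = 0"
          using fundamental_theorem_of_algebra[of p] by (auto simp: constant_degree)
        then obtain q where q: "p = [:- z, 1:] * q" by (auto simp: poly_eq_0_iff_dvd elim: dvdE)
        let ?y = "poly_op M q x"
        have "degree q < degree p" "q \<noteq> 0"
          using less.prems(1) by (auto simp: q degree_mult_eq simp del: mult_pCons_left)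
        moreover have "sc (- z) ?y + M ?y = 0"
          using less.prems(2) unfolding q poly_op_mult[OF M] by (simp add: M M.zero)
        then have "M ?y = sc z ?y" by (simp add: add_eq_0_iff)
        moreover have "?y \<in> S" using S x by (intro poly_op_mem[OF M])
        ultimately show ?thesis using less.hyps by blast
      qed
    qed
  qed
qed

text \<open>Take a complex root a + bi: it is either real or belongs to a conjugate pair with the
  given quadratic as its real polynomial.\<close>

lemma real_poly_factor:
  fixes p :: "real poly"
  assumes "degree p \<noteq> 0"
  obtains a q where "p = [:- a, 1:] * q"
  | a b q where "b \<noteq> 0" "p = [:a\<^sup>2 + b\<^sup>2, - 2 * a, 1:] * q"
proof -
  have "\<not> constant (poly (map_poly complex_of_real p))"
    using assms by (simp add: constant_degree degree_map_poly)
  then obtain z where z: "poly (map_poly complex_of_real p) z = 0"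
    using fundamental_theorem_of_algebra by blast
  define a where "a = Re z"
  define b where "b = Im z"
  have zab: "z = Complex a b" by (simp add: a_def b_def)
  show thesis
  proof (cases "b = 0")
    case True
    then have "z = of_real a" by (simp add: zab complex_eq_iff)
    moreover have "poly (map_poly complex_of_real p) (of_real a) = of_real (poly p a)"
      by (induction p) (simp_all add: map_poly_pCons)
    ultimately have "poly p a = 0" using z by simp
    then show thesis using that(1) by (auto simp: poly_eq_0_iff_dvd elim: dvdE)
  next
    case False
    let ?d = "[:a\<^sup>2 + b\<^sup>2, - 2 * a, 1:]"
    \<comment> \<open>The remainder has degree at most 1, real coefficients and the nonreal root
      \<open>z\<close>, which forces it to be 0.\<close>
    define r where "r = p mod ?d"
    have "r = 0 \<or> degree r < degree ?d" unfolding r_def by (rule degree_mod_less) simp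
    then have "degree r \<le> 1" by auto
    obtain c0 r' where r': "r = pCons c0 r'" by (cases r)
    with \<open>degree r \<le> 1\<close> have "degree r' = 0" by (auto split: if_splits)
    then obtain c1 where "r' = [:c1:]" by (rule degree_eq_zeroE)
    with r' have r: "r = [:c0, c1:]" by simp
    have p: "p = ?d * (p div ?d) + r" unfolding r_def by (rule mult_div_mod_eq[symmetric])
    have "map_poly complex_of_real p =
        map_poly of_real ?d * map_poly of_real (p div ?d) + map_poly of_real r"
      by (subst p, rule poly_eqI) (simp only: coeff_map_poly coeff_mult coeff_add of_real_0
          of_real_add of_real_sum of_real_mult)
    moreover have "poly (map_poly complex_of_real ?d) z = 0"
      by (simp add: map_poly_pCons zab complex_eq_iff power2_eq_square algebra_simps)
    ultimately have "poly (map_poly complex_of_real r) z = 0"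
      using z by simp
    then have "c1 = 0" "c0 = 0" using False by (auto simp: r zab complex_eq_iff map_poly_pCons)
    then show thesis using that(2)[OF False, of a "p div ?d"] p r by simp
  qed
qed

text \<open>The complex descent, with real factors. A linear factor yields an eigenvector or is
  discarded; self-adjointness ensures that a quadratic factor can always be discarded.\<close>

lemma spectral_space_real:
  fixes sc :: "real \<Rightarrow> 'v::ab_group_add \<Rightarrow> 'v"
  assumes "fd_hilbert sc ip"
  shows "spectral_space sc ip"
proof -
  interpret fd_hilbert sc ip by (rule assms)
  show ?thesis
  proof
    show "a = of_real (norm a)" if "0 < a" for a :: real
      using that by simp
    show "conjugate (of_real r :: real) = of_real r" for r by simp
    fix M S assume M: "Vector_Spaces.linear sc sc M" and S: "subspace S" "M ` S \<subseteq> S" "S \<noteq> {0}"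
      and sa: "\<And>x y. x \<in> S \<Longrightarrow> y \<in> S \<Longrightarrow> ip (M x) y = ip x (M y)"
    interpret M: Vector_Spaces.linear sc sc M by (rule M)
    obtain x where x: "x \<in> S" "x \<noteq> 0" using S(1,3) subspace_0 by fastforce
    obtain p where "p \<noteq> 0" "poly_op M p x = 0" using annihilating_poly[OF M] by blast
    then show "\<exists>x\<in>S. x \<noteq> 0 \<and> (\<exists>c. M x = sc c x)"
    proof (induction "degree p" arbitrary: p rule: less_induct)
      case less
      have mem: "poly_op M q x \<in> S" for q using S x by (intro poly_op_mem[OF M])
      show ?case
      proof (cases "degree p = 0")
        case True
        then obtain a where "p = [:a:]" by (rule degree_eq_zeroE)
        then show ?thesis using less.prems x by (simp add: M M.zero)
      next
        case False
        then show ?thesis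
        proof (cases rule: real_poly_factor)
          case (1 z q)
          let ?y = "poly_op M q x"
          have "degree q < degree p" "q \<noteq> 0"
            using less.prems(1) by (auto simp: 1 degree_mult_eq simp del: mult_pCons_left)
          moreover have "sc (- z) ?y + M ?y = 0"
            using less.prems(2) unfolding 1 poly_op_mult[OF M] by (simp add: M M.zero)
          then have "M ?y = sc z ?y" by (simp add: add_eq_0_iff)
          ultimately show ?thesis using less.hyps mem by blast
        next
          case (2 a b q)
          let ?y = "poly_op M q x"
          define w where "w = M ?y - sc a ?y"
          have deg: "degree q < degree p" "q \<noteq> 0"
            using less.prems(1) by (auto simp: 2 degree_mult_eq simp del: mult_pCons_left)
          have y: "?y \<in> S" "M ?y \<in> S" using mem S(2) by auto
          have "sc (a\<^sup>2 + b\<^sup>2) ?y + M (sc (- 2 * a) ?y + M ?y) = 0"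
            using less.prems(2) unfolding 2 poly_op_mult[OF M] by (simp add: M M.zero)
          \<comment> \<open>\<open>((M - a)\<^sup>2 + b\<^sup>2) y = 0\<close> gives \<open>\<parallel>(M - a) y\<parallel>\<^sup>2 + b\<^sup>2 \<parallel>y\<parallel>\<^sup>2 = 0\<close>, as \<open>M\<close> is self-adjoint.\<close>
          then have "ip (sc (a\<^sup>2 + b\<^sup>2) ?y + M (sc (- 2 * a) ?y + M ?y)) ?y = 0" by simp
          then have "(a\<^sup>2 + b\<^sup>2) * ip ?y ?y - 2 * a * ip (M ?y) ?y + ip (M ?y) (M ?y) = 0"
            using sa[OF y(2) y(1)]
            by (simp add: ip_add_left ip_scale_left M.add M.scale ip_minus_left M.diff ip_diff_left)
          moreover have "ip w w = ip (M ?y) (M ?y) - 2 * a * ip (M ?y) ?y + a\<^sup>2 * ip ?y ?y"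
            using sa[OF y(1) y(1)]
            by (simp add: w_def ip_diff_left ip_diff_right ip_scale_left ip_scale_right
                power2_eq_square algebra_simps)
          ultimately have "ip w w + b\<^sup>2 * ip ?y ?y = 0" by (simp add: algebra_simps)
          moreover have "0 \<le> ip w w" using ip_pos[of w] by (cases "w = 0") auto
          moreover have "?y \<noteq> 0 \<Longrightarrow> 0 < b\<^sup>2 * ip ?y ?y" using ip_pos[of ?y] 2 by simp
          ultimately have "?y = 0" by fastforce
          then show ?thesis using less.hyps deg by blast
        qed
      qed
    qed
  qed
qed

theorem theorem1p7:
  fixes scR :: "real \<Rightarrow> 'v::ab_group_add \<Rightarrow> 'v" and ipR :: "'v \<Rightarrow> 'v \<Rightarrow> real"
    and scC :: "complex \<Rightarrow> 'w::ab_group_add \<Rightarrow> 'w" and ipC :: "'w \<Rightarrow> 'w \<Rightarrow> complex"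
  shows
    "(fd_hilbert scR ipR \<and> even (vector_space.dim scR UNIV) \<longrightarrow>
       (\<forall>A. Vector_Spaces.linear scR scR A \<longrightarrow>
         (\<exists>F B V. fd_hilbert.halving scR F \<and>
            fd_hilbert.linear_between scR F F B \<and>
            fd_hilbert.unitary_between scR ipR F (fd_hilbert.perp ipR F) V \<and>
            (\<forall>x\<in>F. fd_hilbert.compression ipR F A x = B x) \<and>
            (\<forall>x\<in>F. fd_hilbert.adjoint_on ipR F V
                       (fd_hilbert.compression ipR (fd_hilbert.perp ipR F) A (V x)) = B x))))
   \<and> (fd_hilbert scC ipC \<and> even (vector_space.dim scC UNIV) \<longrightarrow>
       (\<forall>A. Vector_Spaces.linear scC scC A \<longrightarrow>
         (\<exists>F B V. fd_hilbert.halving scC F \<and>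
            fd_hilbert.linear_between scC F F B \<and>
            fd_hilbert.unitary_between scC ipC F (fd_hilbert.perp ipC F) V \<and>
            (\<forall>x\<in>F. fd_hilbert.compression ipC F A x = B x) \<and>
            (\<forall>x\<in>F. fd_hilbert.adjoint_on ipC F V
                       (fd_hilbert.compression ipC (fd_hilbert.perp ipC F) A (V x)) = B x))))"
  using spectral_space.halving_compressions[OF spectral_space_real]
    spectral_space.halving_compressions[OF spectral_space_complex]
  by blast

end
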